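(* Let $H=H(x,p)$ be a smooth real-valued function of two real variables, and consider the Hamiltonian system $\dot x=H_p$, $\dot p=-H_x$. The discrete gradient scheme $$\frac{x_{n+1}-x_n}{\delta_n}=\frac{H(x_{n+1},p_{n+1})+H(x_n,p_{n+1})-H(x_{n+1},p_n)-H(x_n,p_n)}{2(p_{n+1}-p_n)},$$ $$\frac{p_{n+1}-p_n}{\delta_n}=\frac{H(x_n,p_{n+1})+H(x_n,p_n)-H(x_{n+1},p_{n+1})-H(x_{n+1},p_n)}{2(x_{n+1}-x_n)},$$ with $$\delta_n=\frac{2}{\omega_n}\tan\frac{h\omega_n}{2},\qquad \omega_n=\sqrt{H_{xx}H_{pp}-H_{xp}^2},$$ where $\omega_n$ is evaluated at $(\bar x,\bar p)$, is locally exact. That is, for every fixed point $(\bar x,\bar p)$ and every time step $h>0$ for which $\delta_n$ is defined and positive, the linearization of the scheme around $(\bar x,\bar p)$ is identical with (equivalent, as a relation between $(\xi_n,\eta_n)$ and $(\xi_{n+1},\eta_{n+1})$, to) the exact discretization with time step $h$ of the linearization of the Hamiltonian system around $(\bar x,\bar p)$.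
   Context: Subscripts $x,p$ on $H$ denote partial derivatives, and $h>0$ is the time step. Conventions. When $p_{n+1}=p_n$ or $x_{n+1}=x_n$, the corresponding quotient on the right-hand side of the scheme is understood as its limiting value: the first right-hand side becomes $\tfrac12(H_p(x_{n+1},p_n)+H_p(x_n,p_n))$ if $p_{n+1}=p_n$, and the second becomes $-\tfrac12(H_x(x_n,p_{n+1})+H_x(x_n,p_n))$ if $x_{n+1}=x_n$. With this convention the right-hand sides are smooth functions of $(x_n,p_n,x_{n+1},p_{n+1})$. If $H_{xx}H_{pp}-H_{xp}^2<0$ at $(\bar x,\bar p)$, the same formula for $\delta_n$ is used with imaginary $\omega_n=i\kappa$, $\kappa>0$, so that $\delta_n=\frac{2}{\kappa}\tanh\frac{h\kappa}{2}$; if $H_{xx}H_{pp}-H_{xp}^2=0$ at $(\bar x,\bar p)$, the limit $\omega_n\to0$ is taken, so that $\delta_n=h$. Linearization of the Hamiltonian system around $(\bar x,\bar p)$: put $x=\bar x+\xi$, $p=\bar p+\eta$ and keep terms up to first order in $(\xi,\eta)$, which gives $$\dot\xi=H_p+H_{xp}\xi+H_{pp}\eta,\qquad \dot\eta=-H_x-H_{xx}\xi-H_{xp}\eta,$$ with all derivatives of $H$ evaluated at $(\bar x,\bar p)$. (The point $(\bar x,\bar p)$ need not be an equilibrium.) Exact discretization: a difference equation with time step $h$ is the exact discretization of an ordinary differential equation if its solutions satisfy ${\bf x}_n={\bf x}(t_n)$, $t_{n+1}=t_n+h$, where ${\bf x}(t)$ is the solution of the differential equation with the same initial condition. For a linear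 system $\dot{\bf x}=A{\bf x}+{\bf b}$ with constant $A,{\bf b}$, it is ${\bf x}_{n+1}=e^{hA}{\bf x}_n+\int_0^h e^{sA}{\bf b}\,ds$, which equals $e^{hA}{\bf x}_n+(e^{hA}-I)A^{-1}{\bf b}$ when $A$ is invertible. Linearization of the scheme around $(\bar x,\bar p)$: put $x_n=\bar x+\xi_n$, $p_n=\bar p+\eta_n$, $x_{n+1}=\bar x+\xi_{n+1}$, $p_{n+1}=\bar p+\eta_{n+1}$, treat $\delta_n$ as a constant depending only on $\bar x,\bar p,h$, and replace each right-hand side of the scheme by its first-order Taylor polynomial (constant and linear terms) at $\xi_n=\eta_n=\xi_{n+1}=\eta_{n+1}=0$. The result is a linear (affine) system relating $(\xi_{n+1},\eta_{n+1})$ to $(\xi_n,\eta_n)$. A numerical scheme for an autonomous differential equation is called locally exact if its linearization around any fixed point $\bar{\bf x}$ of phase space is identical with the exact discretization of the differential equation linearized around $\bar{\bf x}$. *)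

theory Defs
  imports "HOL-Analysis.Analysis"
begin

definition Dx :: "(real \<Rightarrow> real \<Rightarrow> real) \<Rightarrow> real \<Rightarrow> real \<Rightarrow> real" where
  "Dx f x p = deriv (\<lambda>s. f s p) x"

definition Dp :: "(real \<Rightarrow> real \<Rightarrow> real) \<Rightarrow> real \<Rightarrow> real \<Rightarrow> real" where
  "Dp f x p = deriv (\<lambda>s. f x s) p"

primrec Ck :: "nat \<Rightarrow> (real \<Rightarrow> real \<Rightarrow> real) \<Rightarrow> bool" where
  "Ck 0 f \<longleftrightarrow> continuous_on UNIV (\<lambda>(x, p). f x p)"
| "Ck (Suc k) f \<longleftrightarrow>
     (\<forall>z. (\<lambda>(x, p). f x p) differentiable (at z)) \<and> Ck k (Dx f) \<and> Ck k (Dp f)"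

definition smooth2 :: "(real \<Rightarrow> real \<Rightarrow> real) \<Rightarrow> bool" where
  "smooth2 f \<longleftrightarrow> (\<forall>k. Ck k f)"

text \<open>First-order Taylor polynomial of \<open>F\<close> at \<open>c\<close>, as a function of the displacement \<open>v\<close>
  from \<open>c\<close>. Meaningful only where \<open>F\<close> is differentiable at \<open>c\<close>.\<close>

definition taylor1 ::
    "('a::real_normed_vector \<Rightarrow> 'b::real_normed_vector) \<Rightarrow> 'a \<Rightarrow> 'a \<Rightarrow> 'b" where
  "taylor1 F c v = F c + frechet_derivative F (at c) v"

text \<open>The one-step relation of the exact discretization of the autonomous equation
  \<open>u' = f u\<close>: by autonomy the step from \<open>t\<^sub>n\<close> to \<open>t\<^sub>n + h\<close> may be taken from \<open>0\<close> to \<open>h\<close>.\<close>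

definition exact_discretization ::
    "('a::real_normed_vector \<Rightarrow> 'a) \<Rightarrow> real \<Rightarrow> 'a \<Rightarrow> 'a \<Rightarrow> bool" where
  "exact_discretization f h w w' \<longleftrightarrow>
     (\<exists>u. (\<forall>t\<in>{0..h}. (u has_vector_derivative f (u t)) (at t within {0..h})) \<and>
          u 0 = w \<and> u h = w')"

text \<open>A scheme here has the form \<open>(z' - z) / \<delta> = G (z, z')\<close>, where \<open>z, z'\<close> are the states at
  steps \<open>n\<close> and \<open>n + 1\<close>. In its linearization around \<open>c\<close>, obtained from \<open>z = c + w\<close> and
  \<open>z' = c + w'\<close>, the number \<open>\<delta>\<close> is kept constant.\<close>

definition scheme ::
    "('a \<times> 'a \<Rightarrow> 'a) \<Rightarrow> real \<Rightarrow> 'a::real_normed_vector \<Rightarrow> 'a \<Rightarrow> bool" where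
  "scheme G \<delta> z z' \<longleftrightarrow> (z' - z) /\<^sub>R \<delta> = G (z, z')"

definition linearized_scheme ::
    "('a \<times> 'a \<Rightarrow> 'a) \<Rightarrow> real \<Rightarrow> 'a::real_normed_vector \<Rightarrow> 'a \<Rightarrow> 'a \<Rightarrow> bool" where
  "linearized_scheme G \<delta> c = scheme (taylor1 G (c, c)) \<delta>"

text \<open>Local exactness of the scheme \<open>(z' - z) / \<delta> c h = G (z, z')\<close> for the equation
  \<open>z' = f z\<close>, where \<open>\<delta> c h\<close> is the denominator belonging to the point \<open>c\<close> and the time
  step \<open>h\<close>, and \<open>adm c h\<close> says which time steps are admissible at \<open>c\<close>.\<close>

definition locally_exact ::
    "('a::real_normed_vector \<Rightarrow> 'a) \<Rightarrow> ('a \<times> 'a \<Rightarrow> 'a) \<Rightarrow> ('a \<Rightarrow> real \<Rightarrow> real) \<Rightarrow>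
     ('a \<Rightarrow> real \<Rightarrow> bool) \<Rightarrow> bool" where
  "locally_exact f G \<delta> adm \<longleftrightarrow>
     (\<forall>c h. adm c h \<longrightarrow>
        (\<forall>w w'. linearized_scheme G (\<delta> c h) c w w' \<longleftrightarrow>
                exact_discretization (taylor1 f c) h w w'))"

definition hamiltonian_field :: "(real \<Rightarrow> real \<Rightarrow> real) \<Rightarrow> real \<times> real \<Rightarrow> real \<times> real" where
  "hamiltonian_field H = (\<lambda>(x, p). (Dp H x p, - Dx H x p))"

text \<open>In the arguments below, \<open>(x, p)\<close> is the state at step \<open>n\<close> and \<open>(x', p')\<close> the state at
  step \<open>n + 1\<close>. The quotients are replaced by their limits where the denominator vanishes.\<close>

definition discrete_gradient ::
    "(real \<Rightarrow> real \<Rightarrow> real) \<Rightarrow> (real \<times> real) \<times> (real \<times> real) \<Rightarrow> real \<times> real" where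
  "discrete_gradient H = (\<lambda>((x, p), (x', p')).
     (if p' = p then (Dp H x' p + Dp H x p) / 2
      else (H x' p' + H x p' - H x' p - H x p) / (2 * (p' - p)),
      if x' = x then - (Dx H x p' + Dx H x p) / 2
      else (H x p' + H x p - H x' p' - H x' p) / (2 * (x' - x))))"

definition hess_det :: "(real \<Rightarrow> real \<Rightarrow> real) \<Rightarrow> real \<times> real \<Rightarrow> real" where
  "hess_det H = (\<lambda>(x, p). Dx (Dx H) x p * Dp (Dp H) x p - (Dp (Dx H) x p)\<^sup>2)"

text \<open>\<open>2 / \<omega> * tan (h * \<omega> / 2)\<close> with \<open>\<omega> = sqrt (hess_det H c)\<close>; for negative \<open>hess_det H c\<close> we have
  \<open>\<omega> = \<i> * \<kappa>\<close>, and for \<open>hess_det H c = 0\<close> the limit \<open>\<omega> \<rightarrow> 0\<close> is taken.\<close>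

definition delta :: "(real \<Rightarrow> real \<Rightarrow> real) \<Rightarrow> real \<times> real \<Rightarrow> real \<Rightarrow> real" where
  "delta H c h =
     (if hess_det H c > 0 then let \<omega> = sqrt (hess_det H c) in 2 / \<omega> * tan (h * \<omega> / 2)
      else if hess_det H c < 0 then let \<kappa> = sqrt (- hess_det H c) in 2 / \<kappa> * tanh (h * \<kappa> / 2)
      else h)"

text \<open>\<open>delta\<close> is undefined exactly at the poles of \<open>tan\<close>, where HOL's total \<open>tan\<close> is \<open>0\<close>.\<close>

definition delta_defined :: "(real \<Rightarrow> real \<Rightarrow> real) \<Rightarrow> real \<times> real \<Rightarrow> real \<Rightarrow> bool" where
  "delta_defined H c h \<longleftrightarrow> (hess_det H c > 0 \<longrightarrow> cos (h * sqrt (hess_det H c) / 2) \<noteq> 0)"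

end

theory Submission
  imports Defs
begin

text \<open>
  Write \<open>f\<close> for the Hamiltonian field and \<open>A\<close> for its derivative at the point \<open>z\<close>. Both
  components of the discrete gradient are averages of difference quotients of \<open>H\<close>, and a
  difference quotient of \<open>H\<close> between \<open>p\<close> and \<open>p'\<close> agrees to first order with the partial
  derivative at the midpoint (\<open>diff_quot_has_derivative\<close>). Hence the linearized scheme is the
  midpoint rule \<open>(w' - w) / \<delta> = f z + A ((w + w') / 2)\<close>
  (\<open>discrete_gradient_has_derivative\<close>).

  The matrix \<open>A\<close> has trace zero because mixed partial derivatives commute, so by
  Cayley-Hamilton \<open>A\<^sup>2 = - D\<close> with \<open>D\<close> the Hessian determinant. All powers of \<open>A\<close> thus reduce
  to \<open>1\<close> and \<open>A\<close>, and both sides can be written down explicitly. Let \<open>s\<close> and \<open>c\<close> be the sine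
  and cosine belonging to the oscillator \<open>y'' = - D y\<close> (hyperbolic if \<open>D < 0\<close>, and \<open>t\<close> and \<open>1\<close>
  if \<open>D = 0\<close>), evaluated at half of the time. With \<open>k = f z + A w\<close>, the exact solution moves
  by \<open>2 s c k + 2 s\<^sup>2 A k\<close>. The midpoint rule has exactly one solution, since the square of
  \<open>(\<delta>/2) A\<close> is a scalar different from \<open>1\<close>, and for \<open>\<delta> / 2 = s / c\<close> it is this same vector
  (\<open>midpoint_iff_exact_discretization\<close>). The three cases in the definition of \<open>delta\<close> are
  three instances of \<open>2 s / c\<close> (\<open>delta_half_angle\<close>).
\<close>

section \<open>Difference quotients to first order\<close>

definition diff_quot :: "(real \<Rightarrow> real \<Rightarrow> real) \<Rightarrow> (real \<Rightarrow> real \<Rightarrow> real) \<Rightarrow>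
    real \<Rightarrow> real \<Rightarrow> real \<Rightarrow> real" where
  "diff_quot F F' x p p' = (if p' = p then F' x p else (F x p' - F x p) / (p' - p))"

lemma diff_quot_commute: "diff_quot F F' x p p' = diff_quot F F' x p' p"
  by (auto simp: diff_quot_def divide_simps algebra_simps)

text \<open>Subtracting \<open>c s\<^sup>2 / 2\<close> from \<open>F x s\<close> lowers the difference quotient by \<open>c\<close> times the
  midpoint, but lowers \<open>F'\<close> by \<open>c \<theta>\<close> at the point \<open>\<theta>\<close> of the mean value theorem. The unknown
  position of \<open>\<theta>\<close> therefore affects only what remains of \<open>F'\<close> after the term \<open>c s\<close> is removed.\<close>

lemma diff_quot_mean_value:
  fixes F F' :: "real \<Rightarrow> real \<Rightarrow> real"
  assumes F: "\<And>x s. (F x has_real_derivative F' x s) (at s)"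
  obtains \<theta> where "\<theta> \<in> closed_segment p p'"
    and "diff_quot F F' x p p' - c * ((p + p') / 2) = F' x \<theta> - c * \<theta>"
proof -
  have ordered: "\<exists>\<theta>. q \<le> \<theta> \<and> \<theta> \<le> q' \<and>
      diff_quot F F' x q q' - c * ((q + q') / 2) = F' x \<theta> - c * \<theta>"
    if "q \<le> q'" for q q'
  proof (cases "q = q'")
    case True
    then show ?thesis by (intro exI[of _ q]) (simp add: diff_quot_def)
  next
    case False
    with that have lt: "q < q'" by simp
    define \<phi> where "\<phi> s = F x s - c * s\<^sup>2 / 2" for s
    have "(\<phi> has_real_derivative (F' x s - c * s)) (at s)" for s
      unfolding \<phi>_def by (auto intro!: derivative_eq_intros F)
    then obtain \<theta> where \<theta>: "q < \<theta>" "\<theta> < q'" "\<phi> q' - \<phi> q = (q' - q) * (F' x \<theta> - c * \<theta>)"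
      using MVT2[OF lt, of \<phi> "\<lambda>s. F' x s - c * s"] by blast
    have "\<phi> q' - \<phi> q = (q' - q) * (diff_quot F F' x q q' - c * ((q + q') / 2))"
      using lt by (simp add: \<phi>_def diff_quot_def field_simps power2_eq_square)
    with \<theta> lt show ?thesis by (intro exI[of _ \<theta>]) simp
  qed
  show thesis
  proof (cases "p \<le> p'")
    case True
    from ordered[OF this] that show ?thesis
      by (auto simp: closed_segment_eq_real_ivl)
  next
    case False
    then have "p' \<le> p" by simp
    from ordered[OF this] False that show ?thesis
      by (auto simp: closed_segment_eq_real_ivl diff_quot_commute[of F F' x p'] add.commute)
  qed
qed

text \<open>The remainder of \<open>F'\<close> at \<open>(x, \<theta>)\<close> bounds that of the quotient, since \<open>\<theta>\<close> lies no further
  from \<open>p0\<close> than the more distant of \<open>p\<close> and \<open>p'\<close>.\<close>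

lemma diff_quot_has_derivative:
  fixes F F' :: "real \<Rightarrow> real \<Rightarrow> real"
  assumes F: "\<And>x s. (F x has_real_derivative F' x s) (at s)"
    and F': "((\<lambda>(x, p). F' x p) has_derivative (\<lambda>(u, v). b * u + c * v)) (at (x0, p0))"
  shows "((\<lambda>(x, p, p'). diff_quot F F' x p p') has_derivative
           (\<lambda>(u, v, v'). b * u + c * ((v + v') / 2))) (at (x0, p0, p0))"
  unfolding has_derivative_at_alt
proof (intro conjI allI impI)
  have eq: "(\<lambda>(u, v, v'). b * u + c * ((v + v') / 2)) =
      (\<lambda>z. b * fst z + c * ((fst (snd z) + snd (snd z)) / 2))"
    by (auto simp: fun_eq_iff)
  show "bounded_linear (\<lambda>(u::real, v::real, v'::real). b * u + c * ((v + v') / 2))"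
    unfolding eq
    by (intro bounded_linear_add bounded_linear_const_mult bounded_linear_divide
        [THEN bounded_linear_compose] bounded_linear_fst bounded_linear_snd
        bounded_linear_fst_comp bounded_linear_snd_comp)
next
  fix e :: real assume "e > 0"
  with F' obtain d where d: "d > 0" and small: "\<And>x p. norm ((x, p) - (x0, p0)) < d \<Longrightarrow>
      norm (F' x p - F' x0 p0 - (b * (x - x0) + c * (p - p0))) \<le> e * norm ((x, p) - (x0, p0))"
    unfolding has_derivative_at_alt by (auto split: prod.splits)
  show "\<exists>d>0. \<forall>y. norm (y - (x0, p0, p0)) < d \<longrightarrow>
      norm ((case y of (x, p, p') \<Rightarrow> diff_quot F F' x p p') -
            (case (x0, p0, p0) of (x, p, p') \<Rightarrow> diff_quot F F' x p p') -
            (case y - (x0, p0, p0) of (u, v, v') \<Rightarrow> b * u + c * ((v + v') / 2)))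
      \<le> e * norm (y - (x0, p0, p0))"
  proof (intro exI[of _ d] conjI allI impI d)
    fix y :: "real \<times> real \<times> real" assume yd: "norm (y - (x0, p0, p0)) < d"
    obtain x p p' where y: "y = (x, p, p')" by (cases y)
    obtain \<theta> where \<theta>: "\<theta> \<in> closed_segment p p'"
      and eq: "diff_quot F F' x p p' - c * ((p + p') / 2) = F' x \<theta> - c * \<theta>"
      using diff_quot_mean_value[OF F] .
    have "\<bar>\<theta> - p0\<bar> \<le> \<bar>p - p0\<bar> \<or> \<bar>\<theta> - p0\<bar> \<le> \<bar>p' - p0\<bar>"
      using \<theta> by (auto simp: closed_segment_eq_real_ivl split: if_splits)
    then have "(\<theta> - p0)\<^sup>2 \<le> (p - p0)\<^sup>2 \<or> (\<theta> - p0)\<^sup>2 \<le> (p' - p0)\<^sup>2"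
      by (simp add: abs_le_square_iff)
    then have "(\<theta> - p0)\<^sup>2 \<le> (p - p0)\<^sup>2 + (p' - p0)\<^sup>2"
      by (smt (verit) zero_le_power2)
    then have le: "norm ((x, \<theta>) - (x0, p0)) \<le> norm (y - (x0, p0, p0))"
      by (simp add: y norm_Pair)
    have "norm (F' x \<theta> - F' x0 p0 - (b * (x - x0) + c * (\<theta> - p0)))
        \<le> e * norm ((x, \<theta>) - (x0, p0))"
      using small le yd by simp
    also have "\<dots> \<le> e * norm (y - (x0, p0, p0))"
      using le \<open>e > 0\<close> by simp
    also have "F' x \<theta> - F' x0 p0 - (b * (x - x0) + c * (\<theta> - p0)) =
        diff_quot F F' x p p' - F' x0 p0 - (b * (x - x0) + c * ((p - p0 + (p' - p0)) / 2))"
      using eq by (simp add: field_simps)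
    finally show "norm ((case y of (x, p, p') \<Rightarrow> diff_quot F F' x p p') -
            (case (x0, p0, p0) of (x, p, p') \<Rightarrow> diff_quot F F' x p p') -
            (case y - (x0, p0, p0) of (u, v, v') \<Rightarrow> b * u + c * ((v + v') / 2)))
      \<le> e * norm (y - (x0, p0, p0))"
      by (simp add: y diff_quot_def)
  qed
qed

lemma diff_quot_has_derivative_compose:
  fixes F F' :: "real \<Rightarrow> real \<Rightarrow> real"
  assumes "\<And>x s. (F x has_real_derivative F' x s) (at s)"
    and "((\<lambda>(x, p). F' x p) has_derivative (\<lambda>(u, v). b * u + c * v)) (at (X z, P z))"
    and "(X has_derivative dX) (at z)" "(P has_derivative dP) (at z)"
    and "(P' has_derivative dP') (at z)" and "P' z = P z"
  shows "((\<lambda>z. diff_quot F F' (X z) (P z) (P' z)) has_derivative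
           (\<lambda>v. b * dX v + c * ((dP v + dP' v) / 2))) (at z)"
proof -
  have "((\<lambda>z. (X z, P z, P' z)) has_derivative (\<lambda>v. (dX v, dP v, dP' v))) (at z)"
    by (intro has_derivative_Pair assms)
  moreover have "((\<lambda>(x, p, p'). diff_quot F F' x p p') has_derivative
      (\<lambda>(u, v, v'). b * u + c * ((v + v') / 2))) (at (X z, P z, P' z))"
    using diff_quot_has_derivative[OF assms(1,2)] assms(6) by simp
  ultimately show ?thesis
    using has_derivative_compose by fastforce
qed

section \<open>Partial derivatives of smooth functions\<close>

lemma smooth2_has_derivative:
  assumes "smooth2 f"
  shows "((\<lambda>(x, p). f x p) has_derivative (\<lambda>(u, v). Dx f x p * u + Dp f x p * v)) (at (x, p))"
proof -
  have "Ck (Suc 0) f" using assms unfolding smooth2_def by blast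
  then obtain D where D: "((\<lambda>(x, p). f x p) has_derivative D) (at (x, p))"
    unfolding Ck.simps differentiable_def by blast
  interpret D: linear D using D by (rule has_derivative_linear)
  have "((\<lambda>s. (\<lambda>(x, p). f x p) (s, p)) has_derivative (\<lambda>u. D (u, 0))) (at x)"
    by (rule has_derivative_compose[where f = "\<lambda>s. (s, p)" and f' = "\<lambda>u. (u, 0)"])
      (intro has_derivative_Pair has_derivative_ident has_derivative_const, rule D)
  moreover have "(\<lambda>u. D (u, 0)) = (*) (D (1, 0))"
  proof
    fix u
    show "D (u, 0) = D (1, 0) * u"
      using D.scaleR[of u "(1, 0)"] by (simp add: mult.commute)
  qed
  ultimately have x: "Dx f x p = D (1, 0)"
    unfolding Dx_def by (intro DERIV_imp_deriv) (simp add: has_field_derivative_def)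
  have "((\<lambda>s. (\<lambda>(x, p). f x p) (x, s)) has_derivative (\<lambda>u. D (0, u))) (at p)"
    by (rule has_derivative_compose[where f = "\<lambda>s. (x, s)" and f' = "\<lambda>u. (0, u)"])
      (intro has_derivative_Pair has_derivative_ident has_derivative_const, rule D)
  moreover have "(\<lambda>u. D (0, u)) = (*) (D (0, 1))"
  proof
    fix u
    show "D (0, u) = D (0, 1) * u"
      using D.scaleR[of u "(0, 1)"] by (simp add: mult.commute)
  qed
  ultimately have p: "Dp f x p = D (0, 1)"
    unfolding Dp_def by (intro DERIV_imp_deriv) (simp add: has_field_derivative_def)
  have "D (u, v) = Dx f x p * u + Dp f x p * v" for u v
    using D.add[of "u *\<^sub>R (1, 0)" "v *\<^sub>R (0, 1)"] by (simp only: D.scaleR) (simp add: x p)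
  then have "D = (\<lambda>(u, v). Dx f x p * u + Dp f x p * v)" by auto
  with D show ?thesis by simp
qed

lemma smooth2_swap_has_derivative:
  assumes "smooth2 f"
  shows "((\<lambda>(p, x). f x p) has_derivative (\<lambda>(v, u). Dp f x p * v + Dx f x p * u)) (at (p, x))"
proof -
  have "((\<lambda>z. (\<lambda>(x, p). f x p) (snd z, fst z)) has_derivative
      (\<lambda>v. (\<lambda>(u, v). Dx f x p * u + Dp f x p * v) (snd v, fst v))) (at (p, x))"
    by (rule has_derivative_compose[where f = "\<lambda>z. (snd z, fst z)" and f' = "\<lambda>v. (snd v, fst v)"])
      (intro has_derivative_Pair has_derivative_fst has_derivative_snd has_derivative_ident,
        simp add: smooth2_has_derivative[OF assms])
  then show ?thesis by (simp add: case_prod_unfold add.commute)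
qed

lemma smooth2_Dx: "smooth2 f \<Longrightarrow> smooth2 (Dx f)"
  and smooth2_Dp: "smooth2 f \<Longrightarrow> smooth2 (Dp f)"
  unfolding smooth2_def using Ck.simps(2) by blast+

lemma smooth2_DERIV_Dp:
  assumes "smooth2 f"
  shows "(f x has_real_derivative Dp f x p) (at p)"
proof -
  have "((\<lambda>s. (\<lambda>(x, p). f x p) (x, s)) has_derivative
      (\<lambda>v. (\<lambda>(u, v). Dx f x p * u + Dp f x p * v) (0, v))) (at p)"
    by (rule has_derivative_compose[where f = "\<lambda>s. (x, s)" and f' = "\<lambda>v. (0, v)"])
      (intro has_derivative_Pair has_derivative_ident has_derivative_const,
        rule smooth2_has_derivative[OF assms])
  then show ?thesis by (simp add: has_field_derivative_def)
qed

lemma smooth2_DERIV_Dx: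
  assumes "smooth2 f"
  shows "((\<lambda>x. f x p) has_real_derivative Dx f x p) (at x)"
proof -
  have "((\<lambda>s. (\<lambda>(x, p). f x p) (s, p)) has_derivative
      (\<lambda>v. (\<lambda>(u, v). Dx f x p * u + Dp f x p * v) (v, 0))) (at x)"
    by (rule has_derivative_compose[where f = "\<lambda>s. (s, p)" and f' = "\<lambda>v. (v, 0)"])
      (intro has_derivative_Pair has_derivative_ident has_derivative_const,
        rule smooth2_has_derivative[OF assms])
  then show ?thesis by (simp add: has_field_derivative_def)
qed

lemmas diff_quot_p_has_derivative =
  diff_quot_has_derivative_compose[OF smooth2_DERIV_Dp smooth2_has_derivative[OF smooth2_Dp]]

lemmas diff_quot_x_has_derivative =
  diff_quot_has_derivative_compose[OF smooth2_DERIV_Dx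
    smooth2_swap_has_derivative[OF smooth2_Dx]]

text \<open>Dividing the second difference of \<open>H\<close> over a square with side \<open>t\<close> by \<open>t\<close> gives a difference
  of quotients in direction \<open>p\<close>, and equally one in direction \<open>x\<close>. This function of \<open>t\<close> is
  differentiable at \<open>0\<close>, with one mixed partial derivative or the other as its derivative.\<close>

lemma smooth2_mixed_partials:
  assumes "smooth2 H"
  shows "Dx (Dp H) x p = Dp (Dx H) x p"
proof -
  let ?Qp = "\<lambda>x p p'. diff_quot H (Dp H) x p p'"
  let ?Qx = "\<lambda>p x x'. diff_quot (\<lambda>p x. H x p) (\<lambda>p x. Dx H x p) p x x'"
  have p: "((\<lambda>t. ?Qp (x + t) p (p + t) - ?Qp x p (p + t)) has_derivative
      (\<lambda>t. (Dx (Dp H) x p * t + Dp (Dp H) x p * ((0 + t) / 2)) -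
           (Dx (Dp H) x p * 0 + Dp (Dp H) x p * ((0 + t) / 2)))) (at 0)"
  proof (rule has_derivative_diff)
    show "((\<lambda>t. ?Qp (x + t) p (p + t)) has_derivative
        (\<lambda>t. Dx (Dp H) x p * t + Dp (Dp H) x p * ((0 + t) / 2))) (at 0)"
      using diff_quot_p_has_derivative[OF assms assms, where X = "\<lambda>t. x + t" and dX = "\<lambda>t. t"
          and P = "\<lambda>t. p" and dP = "\<lambda>t. 0" and P' = "\<lambda>t. p + t" and dP' = "\<lambda>t. t"
          and z = "0::real"]
      by (simp add: has_derivative_ident has_derivative_add_const add.commute[of x] add.commute[of p])
    show "((\<lambda>t. ?Qp x p (p + t)) has_derivative
        (\<lambda>t. Dx (Dp H) x p * 0 + Dp (Dp H) x p * ((0 + t) / 2))) (at 0)"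
      using diff_quot_p_has_derivative[OF assms assms, where X = "\<lambda>t. x" and dX = "\<lambda>t. 0"
          and P = "\<lambda>t. p" and dP = "\<lambda>t. 0" and P' = "\<lambda>t. p + t" and dP' = "\<lambda>t. t"
          and z = "0::real"]
      by (simp add: has_derivative_ident has_derivative_add_const add.commute[of x] add.commute[of p])
  qed
  have x: "((\<lambda>t. ?Qx (p + t) x (x + t) - ?Qx p x (x + t)) has_derivative
      (\<lambda>t. (Dp (Dx H) x p * t + Dx (Dx H) x p * ((0 + t) / 2)) -
           (Dp (Dx H) x p * 0 + Dx (Dx H) x p * ((0 + t) / 2)))) (at 0)"
  proof (rule has_derivative_diff)
    show "((\<lambda>t. ?Qx (p + t) x (x + t)) has_derivative
        (\<lambda>t. Dp (Dx H) x p * t + Dx (Dx H) x p * ((0 + t) / 2))) (at 0)"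
      using diff_quot_x_has_derivative[OF assms assms, where X = "\<lambda>t. p + t" and dX = "\<lambda>t. t"
          and P = "\<lambda>t. x" and dP = "\<lambda>t. 0" and P' = "\<lambda>t. x + t" and dP' = "\<lambda>t. t"
          and z = "0::real"]
      by (simp add: has_derivative_ident has_derivative_add_const add.commute[of x] add.commute[of p])
    show "((\<lambda>t. ?Qx p x (x + t)) has_derivative
        (\<lambda>t. Dp (Dx H) x p * 0 + Dx (Dx H) x p * ((0 + t) / 2))) (at 0)"
      using diff_quot_x_has_derivative[OF assms assms, where X = "\<lambda>t. p" and dX = "\<lambda>t. 0"
          and P = "\<lambda>t. x" and dP = "\<lambda>t. 0" and P' = "\<lambda>t. x + t" and dP' = "\<lambda>t. t"
          and z = "0::real"]
      by (simp add: has_derivative_ident has_derivative_add_const add.commute[of x] add.commute[of p])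
  qed
  have "(\<lambda>t. ?Qp (x + t) p (p + t) - ?Qp x p (p + t)) =
      (\<lambda>t. ?Qx (p + t) x (x + t) - ?Qx p x (x + t))"
    by (auto simp: fun_eq_iff diff_quot_def diff_divide_distrib)
  with x have "((\<lambda>t. ?Qp (x + t) p (p + t) - ?Qp x p (p + t)) has_derivative
      (\<lambda>t. (Dp (Dx H) x p * t + Dx (Dx H) x p * ((0 + t) / 2)) -
           (Dp (Dx H) x p * 0 + Dx (Dx H) x p * ((0 + t) / 2)))) (at 0)"
    by simp
  from has_derivative_unique[OF p this, THEN fun_cong, of 1] show ?thesis by simp
qed

section \<open>The linearization of the scheme\<close>

definition hamiltonian_matrix ::
    "(real \<Rightarrow> real \<Rightarrow> real) \<Rightarrow> real \<times> real \<Rightarrow> real \<times> real \<Rightarrow> real \<times> real" where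
  "hamiltonian_matrix H = (\<lambda>(x, p) (u, v).
     (Dx (Dp H) x p * u + Dp (Dp H) x p * v, - (Dx (Dx H) x p * u + Dp (Dx H) x p * v)))"

lemma hamiltonian_field_has_derivative:
  assumes "smooth2 H"
  shows "(hamiltonian_field H has_derivative hamiltonian_matrix H c) (at c)"
proof -
  obtain x p where c: "c = (x, p)" by (cases c)
  have "((\<lambda>z. ((\<lambda>(x, p). Dp H x p) z, - (\<lambda>(x, p). Dx H x p) z)) has_derivative
      (\<lambda>v. ((\<lambda>(u, v). Dx (Dp H) x p * u + Dp (Dp H) x p * v) v,
           - (\<lambda>(u, v). Dx (Dx H) x p * u + Dp (Dx H) x p * v) v))) (at (x, p))"
    by (intro has_derivative_Pair has_derivative_minus smooth2_has_derivative
        smooth2_Dx smooth2_Dp assms)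
  then show ?thesis
    by (simp add: c hamiltonian_field_def hamiltonian_matrix_def case_prod_unfold)
qed

lemma discrete_gradient_eq_diff_quot:
  "discrete_gradient H = (\<lambda>z.
     let x = fst (fst z); p = snd (fst z); x' = fst (snd z); p' = snd (snd z) in
     ((diff_quot H (Dp H) x' p p' + diff_quot H (Dp H) x p p') / 2,
      - (diff_quot (\<lambda>p x. H x p) (\<lambda>p x. Dx H x p) p' x x' +
         diff_quot (\<lambda>p x. H x p) (\<lambda>p x. Dx H x p) p x x') / 2))"
  by (auto simp: fun_eq_iff discrete_gradient_def diff_quot_def Let_def
      add_divide_distrib diff_divide_distrib mult.commute[of _ 2]
      simp del: right_diff_distrib_numeral left_diff_distrib_numeral)

lemma discrete_gradient_diagonal: "discrete_gradient H (c, c) = hamiltonian_field H c"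
  by (cases c) (simp add: discrete_gradient_def hamiltonian_field_def)

lemma discrete_gradient_has_derivative:
  assumes "smooth2 H"
  shows "(discrete_gradient H has_derivative
           (\<lambda>(w, w'). hamiltonian_matrix H c ((1/2) *\<^sub>R (w + w')))) (at (c, c))"
proof -
  obtain x p where c: "c = (x, p)" by (cases c)
  note p = diff_quot_p_has_derivative[OF assms assms]
  note x = diff_quot_x_has_derivative[OF assms assms]
  let ?z = "((x, p), (x, p))"
  have x: "((\<lambda>z. fst (fst z)) has_derivative (\<lambda>v. fst (fst v))) (at ?z)"
    and p: "((\<lambda>z. snd (fst z)) has_derivative (\<lambda>v. snd (fst v))) (at ?z)"
    and x': "((\<lambda>z. fst (snd z)) has_derivative (\<lambda>v. fst (snd v))) (at ?z)"
    and p': "((\<lambda>z. snd (snd z)) has_derivative (\<lambda>v. snd (snd v))) (at ?z)"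
    for z :: "(real \<times> real) \<times> (real \<times> real)"
    by (auto intro!: derivative_intros)
  note Qp = diff_quot_p_has_derivative[OF assms assms _ p p', simplified]
    and Qx = diff_quot_x_has_derivative[OF assms assms _ x x', simplified]
  show ?thesis
    unfolding discrete_gradient_eq_diff_quot Let_def c
  proof (rule has_derivative_eq_rhs[OF has_derivative_Pair])
    show "((\<lambda>z. (diff_quot H (Dp H) (fst (snd z)) (snd (fst z)) (snd (snd z)) +
          diff_quot H (Dp H) (fst (fst z)) (snd (fst z)) (snd (snd z))) / 2) has_derivative
        (\<lambda>v. ((Dx (Dp H) x p * fst (snd v) + Dp (Dp H) x p * ((snd (fst v) + snd (snd v)) / 2)) +
         (Dx (Dp H) x p * fst (fst v) + Dp (Dp H) x p * ((snd (fst v) + snd (snd v)) / 2))) / 2))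
        (at ?z)"
      using bounded_linear.has_derivative[OF bounded_linear_divide[of 2]
          has_derivative_add[OF Qp[OF x'] Qp[OF x]]] by simp
    show "((\<lambda>z. - (diff_quot (\<lambda>p x. H x p) (\<lambda>p x. Dx H x p) (snd (snd z)) (fst (fst z)) (fst (snd z)) +
          diff_quot (\<lambda>p x. H x p) (\<lambda>p x. Dx H x p) (snd (fst z)) (fst (fst z)) (fst (snd z))) / 2)
        has_derivative
        (\<lambda>v. - ((Dp (Dx H) x p * snd (snd v) + Dx (Dx H) x p * ((fst (fst v) + fst (snd v)) / 2)) +
         (Dp (Dx H) x p * snd (fst v) + Dx (Dx H) x p * ((fst (fst v) + fst (snd v)) / 2))) / 2))
        (at ?z)"
      using bounded_linear.has_derivative[OF bounded_linear_divide[of 2]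
          has_derivative_minus[OF has_derivative_add[OF Qx[OF p'] Qx[OF p]]]]
      by simp
  qed (auto simp: fun_eq_iff hamiltonian_matrix_def field_simps)
qed

section \<open>Midpoint rule and exact flow of an affine system\<close>

text \<open>The energy of the oscillator \<open>y'' = - D y\<close>. Characterizing \<open>s\<close> and \<open>c\<close> by this equation
  and their initial values treats the trigonometric, the hyperbolic and the degenerate case
  at once.\<close>

lemma conserved_energy:
  fixes s c :: "real \<Rightarrow> real"
  assumes s: "\<And>t. (s has_real_derivative c t) (at t)"
    and c: "\<And>t. (c has_real_derivative - D * s t) (at t)"
    and "s 0 = 0" "c 0 = 1"
  shows "(c t)\<^sup>2 + D * (s t)\<^sup>2 = 1"
proof -
  have "((\<lambda>t. (c t)\<^sup>2 + D * (s t)\<^sup>2) has_real_derivative 0) (at t)" for t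
    by (auto intro!: derivative_eq_intros s c)
  then have "(c t)\<^sup>2 + D * (s t)\<^sup>2 = (c 0)\<^sup>2 + D * (s 0)\<^sup>2"
    by (intro DERIV_isconst_all) auto
  then show ?thesis by (simp add: assms)
qed

text \<open>Because \<open>A\<^sup>2 = - D\<close>, the operator \<open>c t - s t A\<close> is \<open>exp (- t A)\<close>, so it carries a solution to
  a constant, and \<open>c t + s t A = exp (t A)\<close> is its inverse.\<close>

lemma linear_ode_zero_unique:
  fixes A :: "'a::real_normed_vector \<Rightarrow> 'a"
  assumes A: "bounded_linear A" and AA: "\<And>v. A (A v) = - (D *\<^sub>R v)"
    and s: "\<And>t. (s has_real_derivative c t) (at t)"
    and c: "\<And>t. (c has_real_derivative - D * s t) (at t)"
    and s0: "s 0 = 0" and c0: "c 0 = 1" and h: "h \<ge> 0"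
    and v: "\<And>t. t \<in> {0..h} \<Longrightarrow> (v has_vector_derivative A (v t)) (at t within {0..h})"
    and v0: "v 0 = 0"
  shows "v h = 0"
proof -
  interpret A: bounded_linear A by fact
  note s' = has_field_derivative_at_within[OF s] and c' = has_field_derivative_at_within[OF c]
  note pyth = conserved_energy[OF s c s0 c0]
  define g where "g t = c t *\<^sub>R v t - s t *\<^sub>R A (v t)" for t
  have "(g has_vector_derivative 0) (at t within {0..h})" if "t \<in> {0..h}" for t
  proof -
    have "(g has_vector_derivative (c t *\<^sub>R A (v t) + (- D * s t) *\<^sub>R v t) -
        (s t *\<^sub>R A (A (v t)) + c t *\<^sub>R A (v t))) (at t within {0..h})"
      unfolding g_def
      by (intro has_vector_derivative_diff has_vector_derivative_scaleR s' c'
          A.has_vector_derivative v that)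
    then show ?thesis by (simp add: AA mult.commute)
  qed
  then obtain k where "\<And>t. t \<in> {0..h} \<Longrightarrow> g t = k"
    using has_vector_derivative_zero_constant[of "{0..h}" g] by auto
  with h have "g h = g 0" by simp
  then have "g h = 0" by (simp add: g_def v0 A.zero)
  then have "0 = c h *\<^sub>R g h + s h *\<^sub>R A (g h)" by (simp add: A.zero)
  also have "\<dots> = ((c h)\<^sup>2 + D * (s h)\<^sup>2) *\<^sub>R v h"
    by (simp add: g_def A.diff A.scaleR AA algebra_simps power2_eq_square)
  finally show ?thesis by (simp add: pyth)
qed

text \<open>Both relations determine \<open>w'\<close> from \<open>w\<close>, so it suffices that the exact solution satisfies the
  midpoint rule. That reduces to two half-angle identities, \<open>S = \<tau> (2 - D E)\<close> and \<open>E = \<tau> S\<close>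
  with \<open>\<tau> = \<delta> / 2\<close>. Here \<open>S\<close> and \<open>E\<close> are the coefficients of the flow, namely
  the first and the second iterated integral of \<open>c\<close> from \<open>0\<close>. They are written through half
  angles from the start because the step size \<open>\<delta>\<close> involves \<open>s\<close> and \<open>c\<close> at \<open>h / 2\<close>.\<close>

lemma midpoint_iff_exact_discretization:
  fixes A :: "'a::real_normed_vector \<Rightarrow> 'a"
  assumes A: "bounded_linear A" and AA: "\<And>v. A (A v) = - (D *\<^sub>R v)"
    and s: "\<And>t. (s has_real_derivative c t) (at t)"
    and c: "\<And>t. (c has_real_derivative - D * s t) (at t)"
    and s0: "s 0 = 0" and c0: "c 0 = 1" and h: "h > 0"
    and ch: "c (h / 2) \<noteq> 0" and \<delta>: "\<delta> = 2 * (s (h / 2) / c (h / 2))" "\<delta> \<noteq> 0"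
  shows "(w' - w) /\<^sub>R \<delta> = b + A ((1/2) *\<^sub>R (w + w')) \<longleftrightarrow>
         exact_discretization (\<lambda>v. b + A v) h w w'"
proof -
  interpret A: bounded_linear A by fact
  note pyth = conserved_energy[OF s c s0 c0]
  define k where "k = b + A w"
  define S where "S t = 2 * s (t / 2) * c (t / 2)" for t
  define E where "E t = 2 * (s (t / 2))\<^sup>2" for t
  (* Variation of constants, as a displacement from w; this form needs no inverse of A. *)
  define u where "u t = w + S t *\<^sub>R k + E t *\<^sub>R A k" for t
  have S': "(S has_real_derivative 1 - D * E t) (at t)" for t
    unfolding S_def E_def using pyth[of "t / 2"]
    by (auto intro!: derivative_eq_intros DERIV_chain2[OF s] DERIV_chain2[OF c]
        simp: power2_eq_square algebra_simps)
  have E': "(E has_real_derivative S t) (at t)" for t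
    unfolding S_def E_def
    by (auto intro!: derivative_eq_intros DERIV_chain2[OF s])
  have u: "(u has_vector_derivative b + A (u t)) (at t within {0..h})" for t
  proof -
    have "(u has_vector_derivative 0 + (S t *\<^sub>R 0 + (1 - D * E t) *\<^sub>R k) + (E t *\<^sub>R 0 + S t *\<^sub>R A k))
        (at t within {0..h})"
      unfolding u_def
      by (intro has_vector_derivative_add has_vector_derivative_scaleR has_vector_derivative_const
          has_field_derivative_at_within[OF S'] has_field_derivative_at_within[OF E'])
    also have "0 + (S t *\<^sub>R 0 + (1 - D * E t) *\<^sub>R k) + (E t *\<^sub>R 0 + S t *\<^sub>R A k) =
        k + S t *\<^sub>R A k - (D * E t) *\<^sub>R k"
      by (simp add: algebra_simps)
    also have "\<dots> = b + A (u t)"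
      by (simp add: u_def A.add A.scaleR AA) (simp add: k_def)
    finally show ?thesis .
  qed
  have u0: "u 0 = w" by (simp add: u_def S_def E_def s0)
  have exact: "exact_discretization (\<lambda>v. b + A v) h w w' \<longleftrightarrow> w' = u h"
  proof
    assume "exact_discretization (\<lambda>v. b + A v) h w w'"
    then obtain v where v: "\<And>t. t \<in> {0..h} \<Longrightarrow>
        (v has_vector_derivative b + A (v t)) (at t within {0..h})" "v 0 = w" "v h = w'"
      unfolding exact_discretization_def by blast
    have "v h - u h = 0"
    proof (rule linear_ode_zero_unique[OF A AA s c s0 c0, where v = "\<lambda>t. v t - u t"])
      fix t assume "t \<in> {0..h}"
      from has_vector_derivative_diff[OF v(1)[OF this] u]
      show "((\<lambda>t. v t - u t) has_vector_derivative A (v t - u t)) (at t within {0..h})"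
        by (simp add: A.diff)
    qed (use h u0 v in auto)
    with v show "w' = u h" by simp
  next
    assume "w' = u h"
    with u u0 show "exact_discretization (\<lambda>v. b + A v) h w w'"
      unfolding exact_discretization_def by blast
  qed
  define \<tau> where "\<tau> = s (h / 2) / c (h / 2)"
  have \<tau>: "\<delta> = 2 * \<tau>" by (simp add: \<delta> \<tau>_def)
  have sh: "s (h / 2) = \<tau> * c (h / 2)" using ch by (simp add: \<tau>_def)
  have "y /\<^sub>R \<delta> = z \<longleftrightarrow> y = \<delta> *\<^sub>R z" for y z :: 'a
    using \<delta>(2) by auto
  then have "(w' - w) /\<^sub>R \<delta> = b + A ((1/2) *\<^sub>R (w + w')) \<longleftrightarrow>
      w' - w = \<delta> *\<^sub>R (b + A ((1/2) *\<^sub>R (w + w')))" for w' .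
  also have "\<delta> *\<^sub>R (b + A ((1/2) *\<^sub>R (w + w'))) = \<delta> *\<^sub>R k + \<tau> *\<^sub>R A (w' - w)" for w'
    by (simp add: \<tau> k_def A.add A.diff A.scaleR algebra_simps flip: scaleR_2)
  finally have scheme: "(w' - w) /\<^sub>R \<delta> = b + A ((1/2) *\<^sub>R (w + w')) \<longleftrightarrow>
      w' - w = \<delta> *\<^sub>R k + \<tau> *\<^sub>R A (w' - w)" for w' .
  have S_\<tau>: "S h = \<tau> * (2 - D * E h)"
    using pyth[of "h / 2"] by (simp add: S_def E_def sh) algebra
  have E_\<tau>: "E h = \<tau> * S h"
    by (simp add: S_def E_def sh power2_eq_square)
  have flow: "u h - w = \<delta> *\<^sub>R k + \<tau> *\<^sub>R A (u h - w)"
  proof -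
    have "\<delta> *\<^sub>R k + \<tau> *\<^sub>R A (u h - w) = (\<tau> * (2 - D * E h)) *\<^sub>R k + (\<tau> * S h) *\<^sub>R A k"
      by (simp add: u_def \<tau> A.add A.scaleR AA algebra_simps)
    also have "\<dots> = u h - w"
      by (simp add: u_def flip: S_\<tau> E_\<tau>)
    finally show ?thesis by simp
  qed
  have "w' = u h" if "w' - w = \<delta> *\<^sub>R k + \<tau> *\<^sub>R A (w' - w)"
  proof -
    define y where "y = w' - u h"
    have y: "y = \<tau> *\<^sub>R A y"
    proof -
      have "y = (w' - w) - (u h - w)" by (simp add: y_def)
      also have "\<dots> = \<tau> *\<^sub>R A (w' - w) - \<tau> *\<^sub>R A (u h - w)"
        by (subst that, subst flow) simp
      finally show ?thesis by (simp add: y_def A.diff algebra_simps)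
    qed
      (* Applying the identity twice turns A into the scalar - D. *)
  have "y = \<tau> *\<^sub>R A (\<tau> *\<^sub>R A y)" using y by simp
    also have "\<dots> = - ((\<tau>\<^sup>2 * D) *\<^sub>R y)"
      by (simp add: A.scaleR AA power2_eq_square)
    finally have "(1 + \<tau>\<^sup>2 * D) *\<^sub>R y = 0"
      by (simp add: scaleR_add_left eq_neg_iff_add_eq_0)
    moreover have "(1 + \<tau>\<^sup>2 * D) * (c (h / 2))\<^sup>2 = 1"
      using pyth[of "h / 2"] by (simp add: sh algebra_simps power_mult_distrib)
    ultimately show ?thesis by (auto simp: y_def)
  qed
  with exact scheme flow show ?thesis by auto
qed

section \<open>Local exactness\<close>

text \<open>Cayley-Hamilton for a matrix of trace zero; the trace vanishes by equality of the mixed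
  partial derivatives.\<close>

lemma hamiltonian_matrix_square:
  assumes "smooth2 H"
  shows "hamiltonian_matrix H c (hamiltonian_matrix H c v) = - (hess_det H c *\<^sub>R v)"
  using smooth2_mixed_partials[OF assms]
  by (cases c; cases v) (simp add: hamiltonian_matrix_def hess_det_def power2_eq_square algebra_simps)

text \<open>Definedness of \<open>delta\<close> is exactly what makes the cosine at the half step nonzero when
  the Hessian determinant is positive; \<open>cosh\<close> and \<open>1\<close> never vanish.\<close>

lemma delta_half_angle:
  assumes "delta_defined H z h"
  obtains s c where
    "\<And>t. (s has_real_derivative c t) (at t)"
    "\<And>t. (c has_real_derivative - hess_det H z * s t) (at t)"
    "s 0 = 0" "c 0 = 1" "c (h / 2) \<noteq> 0" "delta H z h = 2 * (s (h / 2) / c (h / 2))"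
proof -
  consider "hess_det H z > 0" | "hess_det H z < 0" | "hess_det H z = 0" by linarith
  then show thesis
  proof cases
    case 1
    define \<omega> where "\<omega> = sqrt (hess_det H z)"
    have \<omega>: "\<omega> > 0" "hess_det H z = \<omega> * \<omega>" using 1 by (auto simp: \<omega>_def)
    show thesis
    proof (rule that[of "\<lambda>t. sin (\<omega> * t) / \<omega>" "\<lambda>t. cos (\<omega> * t)"])
      show "cos (\<omega> * (h / 2)) \<noteq> 0"
        using assms 1 by (simp add: delta_defined_def \<omega>_def mult.commute)
    qed (use \<omega> 1 in \<open>auto intro!: derivative_eq_intros
          simp: delta_def \<omega>_def[symmetric] Let_def tan_def mult.commute\<close>)
  next
    case 2
    define \<kappa> where "\<kappa> = sqrt (- hess_det H z)"
    have "\<kappa> * \<kappa> = - hess_det H z" using 2 by (simp add: \<kappa>_def)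
    then have \<kappa>: "\<kappa> > 0" "hess_det H z = - (\<kappa> * \<kappa>)" using 2 by (auto simp: \<kappa>_def)
    show thesis
    proof (rule that[of "\<lambda>t. sinh (\<kappa> * t) / \<kappa>" "\<lambda>t. cosh (\<kappa> * t)"])
    qed (use \<kappa> 2 in \<open>auto intro!: derivative_eq_intros
          simp: delta_def \<kappa>_def[symmetric] Let_def tanh_def mult.commute\<close>)
  next
    case 3
    then show thesis
      by (intro that[of "\<lambda>t. t" "\<lambda>t. 1"]) (auto simp: delta_def)
  qed
qed

theorem theorem4p2:
  fixes H :: "real \<Rightarrow> real \<Rightarrow> real"
  assumes "smooth2 H"
  shows "locally_exact (hamiltonian_field H) (discrete_gradient H) (delta H)
           (\<lambda>c h. h > 0 \<and> delta_defined H c h \<and> delta H c h > 0)"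
  unfolding locally_exact_def
proof (intro allI impI, elim conjE)
  fix z h w w'
  assume h: "0 < h" "delta_defined H z h" "0 < delta H z h"
  have A: "bounded_linear (hamiltonian_matrix H z)"
    using hamiltonian_field_has_derivative[OF assms] by (rule has_derivative_bounded_linear)
  have lin_scheme: "taylor1 (discrete_gradient H) (z, z) (w, w') =
      hamiltonian_field H z + hamiltonian_matrix H z ((1/2) *\<^sub>R (w + w'))"
    by (simp add: taylor1_def discrete_gradient_diagonal
        flip: frechet_derivative_at[OF discrete_gradient_has_derivative[OF assms]])
  have lin_field: "taylor1 (hamiltonian_field H) z =
      (\<lambda>v. hamiltonian_field H z + hamiltonian_matrix H z v)"
    by (simp add: fun_eq_iff taylor1_def
        flip: frechet_derivative_at[OF hamiltonian_field_has_derivative[OF assms]])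
  obtain s c where
    "\<And>t. (s has_real_derivative c t) (at t)"
    "\<And>t. (c has_real_derivative - hess_det H z * s t) (at t)"
    "s 0 = 0" "c 0 = 1" "c (h / 2) \<noteq> 0" "delta H z h = 2 * (s (h / 2) / c (h / 2))"
    using delta_half_angle[OF h(2)] by blast
  from midpoint_iff_exact_discretization
      [OF A hamiltonian_matrix_square[OF assms] this(1-4) h(1) this(5,6), of w' w] h(3)
  show "linearized_scheme (discrete_gradient H) (delta H z h) z w w' \<longleftrightarrow>
      exact_discretization (taylor1 (hamiltonian_field H) z) h w w'"
    unfolding linearized_scheme_def scheme_def lin_scheme lin_field by simp
qed

end
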